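(* There exists a convex body $K\subset\mathbb{R}^3$ with non-empty interior such that all the complex roots of the Steiner polynomial $f(K,B_3,s)=\sum_{i=0}^3\binom{3}{i}\mathrm{W}_i(K;B_3)\,s^i$ have real part greater than $-\mathrm{R}(K;B_3)$.
   Context: A convex body is a compact convex set in $\mathbb{R}^n$; $B_n$ is the Euclidean unit ball of $\mathbb{R}^n$. For convex bodies $K,E\subset\mathbb{R}^n$, the relative quermassintegrals $\mathrm{W}_i(K;E)$, $0\le i\le n$, are the coefficients defined by $\mathrm{V}(K+\rho E)=\sum_{i=0}^n\binom{n}{i}\mathrm{W}_i(K;E)\rho^i$ for all $\rho\ge0$, where $\mathrm{V}$ is $n$-dimensional Lebesgue measure. The Steiner polynomial $f(K,E,s)=\sum_{i=0}^n\binom{n}{i}\mathrm{W}_i(K;E)s^i$ is regarded as a polynomial in the complex variable $s$. The relative circumradius is $\mathrm{R}(K;E)=\min\{R:\exists\,x\in\mathbb{R}^n\text{ with }K\subseteq x+RE\}$. *)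

theory Defs
  imports "HOL-Analysis.Analysis" "HOL-Library.Set_Algebras"
    "HOL-Computational_Algebra.Polynomial"
begin

definition convex_body :: "'a::euclidean_space set \<Rightarrow> bool" where
  "convex_body K \<longleftrightarrow> compact K \<and> convex K"

(* The coefficient family is only determined on the indices up to n = DIM('a);
   setting it to 0 beyond n makes it unique, so that THE applies.
   K + \<rho>E is the Minkowski sum. *)
definition quermassintegral :: "'a::euclidean_space set \<Rightarrow> 'a set \<Rightarrow> nat \<Rightarrow> real" where
  "quermassintegral K E =
    (THE W. (\<forall>\<rho>\<ge>0. measure lebesgue (K + (*\<^sub>R) \<rho> ` E)
                  = (\<Sum>i\<le>DIM('a). real (DIM('a) choose i) * W i * \<rho> ^ i))
          \<and> (\<forall>i>DIM('a). W i = 0))"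

definition steiner_poly :: "'a::euclidean_space set \<Rightarrow> 'a set \<Rightarrow> complex poly" where
  "steiner_poly K E =
    (\<Sum>i\<le>DIM('a). monom (of_real (real (DIM('a) choose i) * quermassintegral K E i)) i)"

(* The radius has to be restricted to R \<ge> 0: for E = -E, as for the ball, RE = (-R)E, and
   without the restriction the set of admissible R would be unbounded below. *)
definition rel_circumradius :: "'a::euclidean_space set \<Rightarrow> 'a set \<Rightarrow> real" where
  "rel_circumradius K E = (LEAST R. 0 \<le> R \<and> (\<exists>x. K \<subseteq> (+) x ` (*\<^sub>R) R ` E))"

end

theory Submission
  imports Defs
begin

text \<open>Replacing K by K + B shifts both the roots and -R(K; B) by -1, so it suffices to
  find a flat body: if K is planar with area A and perimeter p, then
  f(K, B, s) = s (2A + (pi/2) p s + (4 pi/3) s^2), and all roots have real part greater than -R as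
  soon as p < 16 R / 3 and 4 pi R^2/3 - pi p R/2 + 2A > 0. A suitable lens (two circular
  arcs over a chord of length 2R) satisfies both; it is approximated here by a centrally symmetric decagon.
  Such a polygon is a sum of segments, and adding a segment to a planar convex body increases its
  area by the length of the segment times the width of the body orthogonal to it.
  This gives the area of the parallel bodies of the decagon, and the spatial volume follows by
  integrating over horizontal slices.\<close>

section \<open>Minkowski sums of balls; oblique slices of planar sets\<close>

lemma compact_plus:
  fixes S T :: "'a::real_normed_vector set"
  assumes "compact S" "compact T"
  shows "compact (S + T)"
proof -
  have "S + T = {x + y | x y. x \<in> S \<and> y \<in> T}"
    by (auto simp: set_plus_def)
  then show ?thesis
    using compact_sums[OF assms] by simp
qed

text \<open>A point of the larger ball is split in the ratio r : s, which keeps each part within its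
  own radius. The case r + s = 0 is treated apart because of the division.\<close>

lemma cball_0_plus_cball_0:
  fixes r s :: real
  assumes "0 \<le> r" "0 \<le> s"
  shows "cball 0 r + cball 0 s = (cball 0 (r + s) :: 'a::real_normed_vector set)"
proof (rule set_eqI, rule iffI)
  fix x :: 'a
  assume "x \<in> cball 0 r + cball 0 s"
  then show "x \<in> cball 0 (r + s)"
    by (auto elim!: set_plus_elim intro: order_trans[OF norm_triangle_ineq])
next
  fix x :: 'a
  assume x: "x \<in> cball 0 (r + s)"
  show "x \<in> cball 0 r + cball 0 s"
  proof (cases "r + s = 0")
    case True
    with x assms have "x = 0" "r = 0" "s = 0" by auto
    then show ?thesis by (auto simp: set_plus_def)
  next
    case False
    with assms have pos: "r + s > 0" by linarith
    have "x = (r / (r + s)) *\<^sub>R x + (s / (r + s)) *\<^sub>R x"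
      using pos by (simp flip: scaleR_add_left add: add_divide_distrib[symmetric])
    moreover have "t / (r + s) * norm x \<le> t" if "0 \<le> t" for t
      using mult_left_mono[of "norm x" "r + s" t] that x pos
      by (simp add: pos_divide_le_eq)
    ultimately show ?thesis
      using assms pos by (subst \<open>x = _\<close>) (intro set_plus_intro; simp)
  qed
qed

lemma scaleR_image_cball_0_1:
  assumes "0 \<le> r"
  shows "(*\<^sub>R) r ` cball 0 1 = (cball 0 r :: 'a::real_normed_vector set)"
  using cball_scale[of r 0 1] assms by (cases "r = 0") (auto simp: image_constant_conv)

text \<open>The slices are those along lines of direction (a, b), indexed by the determinant u of
  (a, b) and a point of the line.\<close>

lemma nn_integral_skew_slices:
  fixes a b :: real and L :: "(real \<times> real) set"
  assumes a: "a > 0" and [measurable]: "L \<in> sets borel"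
  shows "ennreal a * emeasure lborel L
       = (\<integral>\<^sup>+u. emeasure lborel {x. (x, (u + b * x) / a) \<in> L} \<partial>lborel)"
proof -
  have [measurable]: "L \<in> sets (borel \<Otimes>\<^sub>M borel)"
    using assms(2) by (simp add: borel_prod[symmetric])
  have "emeasure lborel L = (\<integral>\<^sup>+x. (\<integral>\<^sup>+y. indicator L (x, y) \<partial>lborel) \<partial>lborel)"
    by (subst lborel_prod[symmetric], subst lborel.emeasure_pair_measure) (auto simp: borel_prod)
  \<comment> \<open>For fixed x this substitutes \<open>y = (u + b * x) / a\<close>, with Jacobian
    1/a. Exchanging the integrals afterwards leaves the slices along direction (a, b), measured by
    their projections to the first axis.\<close>
  also have "\<dots> = (\<integral>\<^sup>+x. ennreal (1/a) * (\<integral>\<^sup>+u. indicator L (x, (b / a) * x + (1/a) * u) \<partial>lborel) \<partial>lborel)"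
    using a by (intro nn_integral_cong, subst nn_integral_real_affine[where c="1/a" and t="(b/a) * x" for x])
       (auto)
  also have "\<dots> = ennreal (1/a) * (\<integral>\<^sup>+x. (\<integral>\<^sup>+u. indicator L (x, (b / a) * x + (1/a) * u) \<partial>lborel) \<partial>lborel)"
    by (intro nn_integral_cmult) measurable
  also have "(\<integral>\<^sup>+x. (\<integral>\<^sup>+u. indicator L (x, (b / a) * x + (1/a) * u) \<partial>lborel) \<partial>lborel)
      = (\<integral>\<^sup>+u. (\<integral>\<^sup>+x. indicator L (x, (b / a) * x + (1/a) * u) \<partial>lborel) \<partial>lborel)"
    by (rule lborel_pair.Fubini'[symmetric]) measurable
  also have "\<dots> = (\<integral>\<^sup>+u. emeasure lborel {x. (x, (u + b * x) / a) \<in> L} \<partial>lborel)"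
  proof (intro nn_integral_cong)
    fix u
    have "(\<integral>\<^sup>+x. indicator L (x, (b / a) * x + (1/a) * u) \<partial>lborel)
        = (\<integral>\<^sup>+x. indicator {x. (x, (u + b * x) / a) \<in> L} x \<partial>lborel)"
      by (intro nn_integral_cong) (auto simp: indicator_def add_divide_distrib add.commute)
    also have "\<dots> = emeasure lborel {x. (x, (u + b * x) / a) \<in> L}"
      by (rule nn_integral_indicator) measurable
    finally show "(\<integral>\<^sup>+x. indicator L (x, (b / a) * x + (1/a) * u) \<partial>lborel)
      = emeasure lborel {x. (x, (u + b * x) / a) \<in> L}" .
  qed
  finally show ?thesis
    using a by (simp add: mult.assoc[symmetric] ennreal_mult[symmetric])
qed


section \<open>Zonotopes and their linear images\<close>

lemma image_plus_linear:
  assumes "linear f"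
  shows "f ` (S + T) = f ` S + f ` T"
proof -
  have "f ` (S + T) = (\<lambda>(x, y). f x + f y) ` (S \<times> T)"
    by (simp add: set_plus_image image_image case_prod_unfold linear_add[OF assms])
  also have "\<dots> = f ` S + f ` T"
    unfolding set_plus_image by force
  finally show ?thesis .
qed

text \<open>The vectors are half-edges: segments centred at 0 make the sum centrally symmetric, and
  each entry v contributes edges of length \<open>2 * norm v\<close>.\<close>

abbreviation zonotope :: "'a::real_vector list \<Rightarrow> 'a set" where
  "zonotope vs \<equiv> sum_list (map (\<lambda>v. closed_segment (- v) v) vs)"

lemma compact_zonotope: "compact (zonotope (vs :: 'a::real_normed_vector list))"
  by (induction vs) (auto simp: set_zero intro: compact_plus)

lemma convex_zonotope: "convex (zonotope vs)"
  by (induction vs) (auto simp: set_zero intro: convex_set_plus)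

lemma sum_list_in_zonotope: "sum_list vs \<in> zonotope vs"
  by (induction vs) (auto simp: set_zero intro!: set_plus_intro)

lemma zero_in_zonotope: "0 \<in> zonotope vs"
proof (induction vs)
  case (Cons v vs)
  have "0 \<in> closed_segment (- v) v"
    unfolding closed_segment_def by (intro CollectI exI[of _ "1/2"]) auto
  then show ?case
    using Cons set_plus_intro[of 0 "closed_segment (- v) v" 0] by simp
qed (simp add: set_zero)

lemma uminus_in_zonotope:
  assumes "x \<in> zonotope vs"
  shows "- x \<in> zonotope vs"
  using assms
proof (induction vs arbitrary: x)
  case (Cons v vs)
  then obtain y z where x: "x = y + z" "y \<in> closed_segment (- v) v" "z \<in> zonotope vs"
    by (auto elim!: set_plus_elim)
  have "- y \<in> uminus ` closed_segment (- v) v"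
    using x(2) by blast
  also have "\<dots> = closed_segment (- v) v"
    using closed_segment_linear_image[of uminus "- v" v]
    by (simp add: linear_uminus closed_segment_commute)
  finally have "- y + - z \<in> closed_segment (- v) v + zonotope vs"
    using Cons.IH[OF x(3)] by (rule set_plus_intro)
  then show ?case
    by (simp add: x(1))
qed (simp add: set_zero)

lemma sum_list_abs_nonneg: "0 \<le> (\<Sum>x\<leftarrow>xs. \<bar>f x :: real\<bar>)"
  by (induction xs) auto

text \<open>A linear functional carries a sum of segments to a sum of centred intervals, whose radii
  add. For the functional \<open>det2 v\<close> below this yields the width of a planar zonotope
  orthogonal to v.\<close>

lemma linear_image_zonotope_real:
  assumes "linear (f :: 'a::real_vector \<Rightarrow> real)"
  shows "f ` zonotope vs = cball 0 (\<Sum>v\<leftarrow>vs. \<bar>f v\<bar>)"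
proof (induction vs)
  case Nil
  then show ?case by (simp add: set_zero linear_0[OF assms])
next
  case (Cons v vs)
  have "f ` closed_segment (- v) v = closed_segment (- f v) (f v)"
    by (simp add: closed_segment_linear_image[OF assms, symmetric] linear_neg[OF assms])
  also have "\<dots> = cball 0 \<bar>f v\<bar>"
    by (auto simp: closed_segment_eq_real_ivl cball_eq_atLeastAtMost)
  finally show ?case
    using sum_list_abs_nonneg[of f vs]
    by (simp add: image_plus_linear[OF assms] Cons cball_0_plus_cball_0)
qed

section \<open>Area gained by adding a segment\<close>

text \<open>As a function of w this is the inner product with v turned by a quarter. It is constant
  along lines of direction v, and the length of the image of a convex body is \<open>norm v\<close>
  times its width orthogonal to v.\<close>

definition det2 :: "real \<times> real \<Rightarrow> real \<times> real \<Rightarrow> real" where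
  "det2 v w = fst v * snd w - snd v * fst w"

lemma linear_det2: "linear (det2 v)"
  by (rule linearI) (auto simp: det2_def algebra_simps)

text \<open>The turned vector has the same norm as v. Cauchy-Schwarz therefore bounds the image, and
  multiples of the turned vector attain every value within the bound.\<close>

lemma det2_image_cball:
  assumes "0 \<le> t" "v \<noteq> 0"
  shows "det2 v ` cball 0 t = cball 0 (t * norm v)"
proof (intro set_eqI iffI)
  have det: "det2 v w = (- snd v, fst v) \<bullet> w" for w
    by (auto simp: det2_def inner_prod_def)
  have nrm: "norm (- snd v, fst v) = norm v"
    by (cases v) (simp add: norm_Pair add.commute)
  fix u :: real
  {
    assume "u \<in> det2 v ` cball 0 t"
    then obtain w where w: "norm w \<le> t" "u = det2 v w" by auto
    have "\<bar>u\<bar> \<le> norm v * norm w"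
      using Cauchy_Schwarz_ineq2[of "(- snd v, fst v)" w] by (simp add: w det nrm)
    also have "\<dots> \<le> norm v * t"
      using w by (intro mult_left_mono) auto
    finally show "u \<in> cball 0 (t * norm v)" by (simp add: mult.commute)
  }
  assume u: "u \<in> cball 0 (t * norm v)"
  define w where "w = (u / (norm v)\<^sup>2) *\<^sub>R (- snd v, fst v)"
  have "det2 v w = u / (norm v)\<^sup>2 * (norm (- snd v, fst v))\<^sup>2"
    unfolding w_def det inner_scaleR_right power2_norm_eq_inner ..
  then have "det2 v w = u"
    using assms by (simp add: nrm)
  moreover have "norm w \<le> t"
    using u assms unfolding w_def norm_scaleR nrm by (simp add: power2_eq_square pos_divide_le_eq)
  ultimately show "u \<in> det2 v ` cball 0 t"
    by force
qed

lemma det2_image_zonotope_plus_cball: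
  assumes "0 \<le> t" "v \<noteq> 0"
  shows "det2 v ` (zonotope vs + cball 0 t) = cball 0 ((\<Sum>w\<leftarrow>vs. \<bar>det2 v w\<bar>) + t * norm v)"
  using assms sum_list_abs_nonneg[of "det2 v" vs]
  by (simp add: image_plus_linear linear_det2 linear_image_zonotope_real
      det2_image_cball cball_0_plus_cball_0)

lemma emeasure_closed_segment_plus:
  fixes L :: "(real \<times> real) set"
  assumes L: "compact L" "convex L" and v: "fst v > 0"
  shows "emeasure lborel (closed_segment (- v) v + L)
       = emeasure lborel L + 2 * emeasure lborel (det2 v ` L)"
proof -
  obtain a b where ab: "v = (a, b)" by force
  with v have a: "a > 0" by simp
  define S where "S u = {x. (x, (u + b * x) / a) \<in> L}" for u
  define S' where "S' u = {x. (x, (u + b * x) / a) \<in> closed_segment (- v) v + L}" for u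
  have [measurable]: "L \<in> sets borel" "closed_segment (- v) v + L \<in> sets borel" "det2 v ` L \<in> sets borel"
    using L by (auto intro!: borel_compact compact_plus compact_continuous_image
      linear_continuous_on simp: linear_conv_bounded_linear[symmetric] linear_det2)
  \<comment> \<open>As the projection of L cut by a line, the slice inherits compactness and
    convexity, which makes it an interval.\<close>
  have S_eq: "S u = fst ` (L \<inter> {p. det2 v p = u})" for u
  proof -
    have "det2 v (x, y) = u \<longleftrightarrow> y = (u + b * x) / a" for x y
      using a by (auto simp: det2_def ab field_simps)
    then show ?thesis
      unfolding S_def by (intro set_eqI) (simp add: image_iff Bex_def)
  qed
  have S_interval: "\<exists>l r. S u = {l..r}" for u
  proof -
    have "closed {p. det2 v p = u}"
      by (auto intro!: closed_Collect_eq continuous_intros simp: det2_def)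
    then have "compact (S u)"
      unfolding S_eq using L
      by (intro compact_continuous_image continuous_intros) auto
    moreover have "convex {p. det2 v p = u}"
      using convex_linear_vimage[OF linear_det2, of "{u}" v] by (simp add: vimage_def)
    then have "convex (S u)"
      unfolding S_eq using L by (intro convex_linear_image linear_fst convex_Int)
    ultimately show ?thesis
      by (metis convex_connected connected_compact_interval_1)
  qed
  have seg: "closed_segment (- v) v = (\<lambda>r. r *\<^sub>R v) ` {-1..1}"
  proof -
    have "closed_segment (- v) v = (\<lambda>r. r *\<^sub>R v) ` closed_segment (-1) 1"
      using closed_segment_linear_image[of "\<lambda>r. r *\<^sub>R v" "-1" 1]
      by (simp add: linear_iff scaleR_add_left)
    then show ?thesis
      by (simp add: closed_segment_eq_real_ivl)
  qed
  \<comment> \<open>Adding \<open>r *\<^sub>R v\<close> does not change \<open>det2 v\<close>, so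
    points move only within their own line, by r * a in the first coordinate.\<close>
  have S'_eq: "S' u = (\<Union>r\<in>{-1..1}. (+) (r * a) ` S u)" for u
  proof (intro set_eqI iffI)
    fix x
    have aux: "(u + b * (x - r * a)) / a = (u + b * x) / a - r * b" for r
      using a by (simp add: field_simps)
    have "x \<in> S' u \<longleftrightarrow> (\<exists>r\<in>{-1..1}. (x, (u + b * x) / a) - r *\<^sub>R v \<in> L)"
      unfolding S'_def seg by (force simp: set_plus_def algebra_simps)
    also have "\<dots> \<longleftrightarrow> (\<exists>r\<in>{-1..1}. x - r * a \<in> S u)"
      unfolding S_def ab by (simp add: aux)
    finally have *: "x \<in> S' u \<longleftrightarrow> (\<exists>r\<in>{-1..1}. x - r * a \<in> S u)" .
    {
      assume "x \<in> S' u"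
      then show "x \<in> (\<Union>r\<in>{-1..1}. (+) (r * a) ` S u)"
        unfolding * by (force simp: image_iff)
    }
    assume "x \<in> (\<Union>r\<in>{-1..1}. (+) (r * a) ` S u)"
    then show "x \<in> S' u"
      unfolding * by (force simp: image_iff)
  qed
  have slice: "emeasure lborel (S' u) = emeasure lborel (S u) + ennreal (2 * a) * indicator (det2 v ` L) u" for u
  proof -
    have mem: "u \<in> det2 v ` L \<longleftrightarrow> S u \<noteq> {}"
      by (auto simp: S_eq)
    obtain l r where lr: "S u = {l..r}" using S_interval by blast
    show ?thesis
    proof (cases "l \<le> r")
      case True
      have "S' u = {l - a..r + a}"
      proof (intro set_eqI iffI)
        fix x assume "x \<in> S' u"
        then obtain q where "q \<in> {-1..1}" "x - q * a \<in> {l..r}"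
          by (auto simp: S'_eq lr)
        moreover from this have "q * a \<le> a" "- a \<le> q * a"
          using a mult_right_mono[of q 1 a] mult_right_mono[of "-1" q a] by auto
        ultimately show "x \<in> {l - a..r + a}" by auto
      next
        fix x assume x: "x \<in> {l - a..r + a}"
        \<comment> \<open>The point of the interval nearest to x, which is at distance at most
          a.\<close>
        define y where "y = max l (min r x)"
        have "(x - y) / a \<in> {-1..1}" "y \<in> {l..r}"
          using x a True by (auto simp: y_def field_simps max_def min_def)
        moreover have "x = (x - y) / a * a + y" using a by simp
        ultimately show "x \<in> S' u"
          unfolding S'_eq lr by blast
      qed
      then show ?thesis
        using True mem a by (simp add: lr ennreal_plus[symmetric] del: ennreal_plus)
    next
      case False
      then show ?thesis using mem by (simp add: S'_eq lr)
    qed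
  qed
  \<comment> \<open>The slices are sections of one Borel set in the (u, x) plane, so their lengths
    depend measurably on u and the integral of the sum may be split.\<close>
  have meas: "(\<lambda>u. emeasure lborel (S u)) \<in> borel_measurable borel"
  proof -
    have "(\<lambda>(u, x). (x, (u + b * x) / a)) -` L \<in> sets (borel :: (real \<times> real) measure)"
      using a by (intro borel_measurable_continuous_onI[THEN measurable_sets_borel]) 
         (auto intro!: continuous_intros simp: case_prod_unfold)
    then have "(\<lambda>(u, x). (x, (u + b * x) / a)) -` L \<in> sets (lborel \<Otimes>\<^sub>M lborel)"
      by (simp only: lborel_prod sets_lborel)
    then have "(\<lambda>u. emeasure lborel (Pair u -` ((\<lambda>(u, x). (x, (u + b * x) / a)) -` L))) \<in> borel_measurable lborel"
      by (rule lborel.measurable_emeasure_Pair)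
    then show ?thesis by (simp add: S_def vimage_def)
  qed
  have "ennreal a * emeasure lborel (closed_segment (- v) v + L) = (\<integral>\<^sup>+u. emeasure lborel (S' u) \<partial>lborel)"
    unfolding S'_def using a by (intro nn_integral_skew_slices) measurable
  also have "\<dots> = (\<integral>\<^sup>+u. emeasure lborel (S u) \<partial>lborel) + ennreal (2 * a) * emeasure lborel (det2 v ` L)"
    unfolding slice using meas by (subst nn_integral_add) (auto simp: nn_integral_cmult_indicator)
  also have "(\<integral>\<^sup>+u. emeasure lborel (S u) \<partial>lborel) = ennreal a * emeasure lborel L"
    unfolding S_def using a by (intro nn_integral_skew_slices[symmetric]) measurable
  also have "ennreal a * emeasure lborel L + ennreal (2 * a) * emeasure lborel (det2 v ` L)
     = ennreal a * (emeasure lborel L + 2 * emeasure lborel (det2 v ` L))"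
    using a by (simp add: ennreal_mult distrib_left mult_ac)
  finally show ?thesis
    using a by (simp add: ennreal_mult_cancel_left)
qed


section \<open>Areas of the parallel bodies of a planar zonotope\<close>

text \<open>This is a quarter of the area of the planar zonotope, since the parallelogram with edges
  2v and 2w has area \<open>4 * \<bar>det2 v w\<bar>\<close>.\<close>

fun sum_abs_det2 :: "(real \<times> real) list \<Rightarrow> real" where
  "sum_abs_det2 [] = 0"
| "sum_abs_det2 (v # vs) = (\<Sum>w\<leftarrow>vs. \<bar>det2 v w\<bar>) + sum_abs_det2 vs"

lemma sum_abs_det2_nonneg: "0 \<le> sum_abs_det2 vs"
  by (induction vs) (auto intro!: add_nonneg_nonneg sum_list_abs_nonneg)

lemma sum_list_norm_nonneg: "0 \<le> (\<Sum>v\<leftarrow>vs. norm v)"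
  by (induction vs) auto

text \<open>The planar Steiner formula, by adding one segment at a time. The new segment contributes
  four times the half-length of the image under \<open>det2 v\<close>: the determinants in it extend
  the area term, and \<open>t * norm v\<close> extends the perimeter term.\<close>

lemma emeasure_zonotope_plus_cball_plane:
  fixes vs :: "(real \<times> real) list"
  assumes t: "0 \<le> t" and vs: "\<forall>v\<in>set vs. fst v > 0"
  shows "emeasure lborel (zonotope vs + cball 0 t)
       = ennreal (pi * t\<^sup>2 + 4 * (\<Sum>v\<leftarrow>vs. norm v) * t + 4 * sum_abs_det2 vs)"
  using vs
proof (induction vs)
  case Nil
  then show ?case
    using t by (simp add: emeasure_cball unit_ball_vol_2 power2_eq_square)
next
  case (Cons v vs)
  let ?L = "zonotope vs + cball 0 t"
  define A where "A = pi * t\<^sup>2 + 4 * (\<Sum>v\<leftarrow>vs. norm v) * t + 4 * sum_abs_det2 vs"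
  define w where "w = (\<Sum>w\<leftarrow>vs. \<bar>det2 v w\<bar>) + t * norm v"
  have A: "0 \<le> A"
    using t sum_list_norm_nonneg[of vs] sum_abs_det2_nonneg[of vs] by (simp add: A_def)
  have w: "0 \<le> w"
    using t sum_list_abs_nonneg[of "det2 v" vs] by (simp add: w_def)
  have "v \<noteq> 0" using Cons.prems by auto
  then have "det2 v ` ?L = cball 0 w"
    unfolding w_def by (rule det2_image_zonotope_plus_cball[OF t])
  then have "emeasure lborel (det2 v ` ?L) = ennreal (2 * w)"
    using w by (simp add: cball_eq_atLeastAtMost)
  then have "emeasure lborel (closed_segment (- v) v + ?L) = ennreal A + 2 * ennreal (2 * w)"
    using Cons by (subst emeasure_closed_segment_plus)
      (auto simp: A_def intro!: compact_plus compact_zonotope convex_set_plus convex_zonotope)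
  also have "\<dots> = ennreal (A + 4 * w)"
    using A w by (simp add: ennreal_plus ennreal_mult[of 2, symmetric] mult.assoc flip: ennreal_numeral)
  finally show ?case
    by (simp add: A_def w_def add.assoc algebra_simps)
qed

section \<open>From planar areas to spatial volume by horizontal slices\<close>

text \<open>By Pythagoras, a ball of radius r centred at height 0 meets height z in a ball of radius
  \<open>sqrt (r\<^sup>2 - z\<^sup>2)\<close>; the slice is the union of these over the centres in
  Z.\<close>

lemma Times_singleton_plus_cball_slice:
  fixes Z :: "'b::real_normed_vector set" and z :: real
  shows "Pair z -` ({0} \<times> Z + cball 0 r) =
    (if \<bar>z\<bar> \<le> r then Z + cball 0 (sqrt (r\<^sup>2 - z\<^sup>2)) else {})"
proof -
  have norm_le: "norm (z, y) \<le> r \<longleftrightarrow> \<bar>z\<bar> \<le> r \<and> norm y \<le> sqrt (r\<^sup>2 - z\<^sup>2)" for y :: 'b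
  proof (cases "\<bar>z\<bar> \<le> r")
    case True
    then have "z\<^sup>2 \<le> r\<^sup>2" "0 \<le> r" by (auto simp: abs_le_square_iff[symmetric])
    have "norm (z, y) \<le> r \<longleftrightarrow> z\<^sup>2 + (norm y)\<^sup>2 \<le> r\<^sup>2"
      using \<open>0 \<le> r\<close> by (auto simp: norm_Pair intro: real_le_lsqrt dest: sqrt_le_D)
    also have "\<dots> \<longleftrightarrow> norm y \<le> sqrt (r\<^sup>2 - z\<^sup>2)"
      using \<open>z\<^sup>2 \<le> r\<^sup>2\<close> real_sqrt_le_iff[of "(norm y)\<^sup>2" "r\<^sup>2 - z\<^sup>2"] by auto
    finally show ?thesis using True by simp
  next
    case False
    have "\<bar>z\<bar> \<le> norm (z, y)" using norm_fst_le[of z y] by simp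
    with False show ?thesis by auto
  qed
  have "x \<in> Pair z -` ({0} \<times> Z + cball 0 r) \<longleftrightarrow> (\<exists>p\<in>Z. norm (z, x - p) \<le> r)" for x
    by (force simp: set_plus_def)
  also have "\<dots> x \<longleftrightarrow> \<bar>z\<bar> \<le> r \<and> x \<in> Z + cball 0 (sqrt (r\<^sup>2 - z\<^sup>2))" for x
    unfolding norm_le by (force simp: set_plus_def)
  finally show ?thesis by auto
qed

lemma emeasure_Times_singleton_plus_cball:
  fixes Z :: "'b::euclidean_space set"
  assumes "compact Z"
  shows "emeasure lborel ({0 :: real} \<times> Z + cball 0 r) =
    (\<integral>\<^sup>+z. emeasure lborel (Z + cball 0 (sqrt (r\<^sup>2 - z\<^sup>2))) * indicator {-r..r} z \<partial>lborel)"
proof -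
  have "{0 :: real} \<times> Z + cball 0 r \<in> sets (lborel \<Otimes>\<^sub>M lborel)"
    unfolding lborel_prod sets_lborel using assms
    by (intro borel_compact compact_plus compact_Times compact_cball) auto
  from lborel.emeasure_pair_measure_alt[OF this]
  show ?thesis
    by (simp only: lborel_prod Times_singleton_plus_cball_slice)
       (auto intro!: nn_integral_cong simp: indicator_def)
qed

text \<open>The integral is obtained without calculus: the slice formula for the one-point set {0}
  describes a ball, whose volume is known.\<close>

lemma nn_integral_cball_slices:
  fixes r :: real
  assumes "0 \<le> r"
  shows "(\<integral>\<^sup>+z. ennreal (unit_ball_vol (DIM('b::euclidean_space)) * sqrt (r\<^sup>2 - z\<^sup>2) ^ DIM('b))
             * indicator {-r..r} z \<partial>lborel)
    = ennreal (unit_ball_vol (DIM(real \<times> 'b)) * r ^ DIM(real \<times> 'b))"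
proof -
  have "(\<integral>\<^sup>+z. ennreal (unit_ball_vol (DIM('b)) * sqrt (r\<^sup>2 - z\<^sup>2) ^ DIM('b)) * indicator {-r..r} z \<partial>lborel)
      = (\<integral>\<^sup>+z. emeasure lborel ({0 :: 'b} + cball 0 (sqrt (r\<^sup>2 - z\<^sup>2))) * indicator {-r..r} z \<partial>lborel)"
  proof (intro nn_integral_cong)
    fix z
    have "0 \<le> sqrt (r\<^sup>2 - z\<^sup>2)" if "z \<in> {-r..r}"
      using that abs_le_square_iff[of z r] by auto
    then show "ennreal (unit_ball_vol (DIM('b)) * sqrt (r\<^sup>2 - z\<^sup>2) ^ DIM('b)) * indicator {-r..r} z
      = emeasure lborel ({0 :: 'b} + cball 0 (sqrt (r\<^sup>2 - z\<^sup>2))) * indicator {-r..r} z"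
      by (cases "z \<in> {-r..r}") (simp_all add: set_zero[symmetric] emeasure_cball del: set_zero)
  qed
  also have "\<dots> = emeasure lborel ({0 :: real} \<times> {0 :: 'b} + cball 0 r)"
    by (rule emeasure_Times_singleton_plus_cball[symmetric]) simp
  also have "{0 :: real} \<times> {0 :: 'b} = 0"
    by (auto simp: zero_prod_def)
  finally show ?thesis
    using assms by (simp add: emeasure_cball del: set_zero DIM_prod)
qed

lemma nn_integral_disc_slices:
  assumes "0 \<le> r"
  shows "(\<integral>\<^sup>+z. ennreal (2 * sqrt (r\<^sup>2 - z\<^sup>2)) * indicator {-r..r} z \<partial>lborel) = ennreal (pi * r\<^sup>2)"
  using nn_integral_cball_slices[OF assms, where 'b=real]
  by (simp add: unit_ball_vol_1 unit_ball_vol_2 power2_eq_square)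

lemma nn_integral_ball_slices:
  assumes "0 \<le> r"
  shows "(\<integral>\<^sup>+z. ennreal (pi * (sqrt (r\<^sup>2 - z\<^sup>2))\<^sup>2) * indicator {-r..r} z \<partial>lborel) = ennreal (4 / 3 * pi * r ^ 3)"
  using nn_integral_cball_slices[OF assms, where 'b="real \<times> real"]
  by (simp add: unit_ball_vol_2 unit_ball_vol_3 power2_eq_square power3_eq_cube mult_ac
        del: real_sqrt_mult_self)

text \<open>The terms of the planar formula at radius \<open>sqrt (r\<^sup>2 - z\<^sup>2)\<close>
  integrate separately: the quadratic one to the volume of a ball, the linear one to a multiple of
  the area of a disc, the constant one to a multiple of the length 2r.\<close>

lemma emeasure_zonotope_plus_cball_space:
  fixes vs :: "(real \<times> real) list"
  assumes r: "0 \<le> r" and vs: "\<forall>v\<in>set vs. fst v > 0"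
  shows "emeasure lborel ({0 :: real} \<times> zonotope vs + cball 0 r)
       = ennreal (4 / 3 * pi * r ^ 3 + 2 * pi * (\<Sum>v\<leftarrow>vs. norm v) * r\<^sup>2 + 8 * sum_abs_det2 vs * r)"
proof -
  define \<Lambda> where "\<Lambda> = (\<Sum>v\<leftarrow>vs. norm v)"
  define C where "C = sum_abs_det2 vs"
  have nonneg: "0 \<le> \<Lambda>" "0 \<le> C"
    by (simp_all add: \<Lambda>_def C_def sum_list_norm_nonneg sum_abs_det2_nonneg)
  have "emeasure lborel ({0 :: real} \<times> zonotope vs + cball 0 r)
     = (\<integral>\<^sup>+z. (ennreal (pi * (sqrt (r\<^sup>2 - z\<^sup>2))\<^sup>2) * indicator {-r..r} z
             + ennreal (2 * \<Lambda>) * (ennreal (2 * sqrt (r\<^sup>2 - z\<^sup>2)) * indicator {-r..r} z))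
             + ennreal (4 * C) * indicator {-r..r} z \<partial>lborel)"
    unfolding emeasure_Times_singleton_plus_cball[OF compact_zonotope]
  proof (intro nn_integral_cong)
    fix z
    show "emeasure lborel (zonotope vs + cball 0 (sqrt (r\<^sup>2 - z\<^sup>2))) * indicator {-r..r} z
       = (ennreal (pi * (sqrt (r\<^sup>2 - z\<^sup>2))\<^sup>2) * indicator {-r..r} z
             + ennreal (2 * \<Lambda>) * (ennreal (2 * sqrt (r\<^sup>2 - z\<^sup>2)) * indicator {-r..r} z))
             + ennreal (4 * C) * indicator {-r..r} z"
    proof (cases "z \<in> {-r..r}")
      case True
      then have "\<bar>z\<bar> \<le> \<bar>r\<bar>" by auto
      then have "0 \<le> sqrt (r\<^sup>2 - z\<^sup>2)" by (simp add: abs_le_square_iff)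
      then show ?thesis
        using nonneg True
        by (simp add: emeasure_zonotope_plus_cball_plane[OF _ vs] ennreal_plus[symmetric]
           ennreal_mult[symmetric] \<Lambda>_def[symmetric] C_def[symmetric] mult_ac
           del: ennreal_plus real_sqrt_pow2 real_sqrt_pow2_iff)
    qed simp
  qed
  also have "\<dots> = ennreal (4 / 3 * pi * r ^ 3) + ennreal (2 * \<Lambda>) * ennreal (pi * r\<^sup>2)
      + ennreal (4 * C) * ennreal (2 * r)"
    using r by (subst nn_integral_add, measurable, subst nn_integral_add, measurable, subst nn_integral_cmult, measurable)
      (simp only: nn_integral_disc_slices nn_integral_ball_slices, simp add: nn_integral_cmult_indicator)
  also have "\<dots> = ennreal (4 / 3 * pi * r ^ 3 + 2 * pi * \<Lambda> * r\<^sup>2 + 8 * C * r)"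
    using r nonneg by (simp add: ennreal_plus[symmetric] ennreal_mult[symmetric] mult_ac del: ennreal_plus)
  finally show ?thesis
    by (simp add: \<Lambda>_def C_def)
qed


section \<open>Reading off the Steiner polynomial from volumes\<close>

text \<open>Two polynomials that agree on all nonnegative reals are equal, because their difference
  has infinitely many roots. This makes the family in the \<open>THE\<close> unique; beyond the
  dimension both sides of the conclusion vanish.\<close>

lemma quermassintegral_eqI:
  fixes K E :: "'a::euclidean_space set"
  assumes vol: "\<And>\<rho>. 0 \<le> \<rho> \<Longrightarrow> measure lebesgue (K + (*\<^sub>R) \<rho> ` E) = poly p \<rho>"
    and deg: "degree p \<le> DIM('a)"
  shows "real (DIM('a) choose i) * quermassintegral K E i = coeff p i"
proof -
  let ?P = "\<lambda>W. (\<forall>\<rho>\<ge>0. measure lebesgue (K + (*\<^sub>R) \<rho> ` E)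
                  = (\<Sum>i\<le>DIM('a). real (DIM('a) choose i) * W i * \<rho> ^ i))
          \<and> (\<forall>i>DIM('a). W i = 0)"
  define W where "W i = coeff p i / real (DIM('a) choose i)" for i
  have W: "real (DIM('a) choose i) * W i = coeff p i" for i
    using deg by (cases "i \<le> DIM('a)") (auto simp: W_def coeff_eq_0)
  have "poly p \<rho> = (\<Sum>i\<le>DIM('a). coeff p i * \<rho> ^ i)" for \<rho>
    unfolding poly_altdef using deg by (intro sum.mono_neutral_left) (auto simp: coeff_eq_0)
  then have "?P W"
    using deg by (simp add: vol W) (simp add: W_def coeff_eq_0)
  moreover have "V = W" if V: "?P V" for V
  proof
    fix i
    define q where "q = (\<Sum>i\<le>DIM('a). monom (real (DIM('a) choose i) * V i) i)"
    have "poly q \<rho> = poly p \<rho>" if "0 \<le> \<rho>" for \<rho>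
      using V vol that by (simp add: q_def poly_sum poly_monom)
    then have "{0..} \<subseteq> {\<rho>. poly (q - p) \<rho> = 0}"
      by auto
    then have "infinite {\<rho>. poly (q - p) \<rho> = 0}"
      using infinite_Ici finite_subset by blast
    then have "q = p"
      using poly_roots_finite[of "q - p"] by auto
    have "real (DIM('a) choose i) * V i = coeff q i" if "i \<le> DIM('a)"
      using that by (simp add: q_def coeff_sum coeff_monom)
    then show "V i = W i"
      using V deg by (cases "i \<le> DIM('a)") (auto simp: W_def \<open>q = p\<close> coeff_eq_0 field_simps)
  qed
  ultimately have "quermassintegral K E = W"
    unfolding quermassintegral_def by (intro the_equality) auto
  then show ?thesis
    by (simp add: W)
qed

lemma steiner_poly_eqI:
  fixes K E :: "'a::euclidean_space set"
  assumes "\<And>\<rho>. 0 \<le> \<rho> \<Longrightarrow> measure lebesgue (K + (*\<^sub>R) \<rho> ` E) = poly p \<rho>"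
    and "degree p \<le> DIM('a)"
  shows "steiner_poly K E = map_poly of_real p"
proof (rule poly_eqI)
  fix n
  show "coeff (steiner_poly K E) n = coeff (map_poly of_real p) n"
    using assms(2) unfolding steiner_poly_def
    by (simp only: quermassintegral_eqI[OF assms], cases "n \<le> DIM('a)")
       (auto simp: coeff_sum coeff_monom coeff_map_poly coeff_eq_0)
qed

section \<open>Circumradius of symmetric sets and location of quadratic roots\<close>

text \<open>A ball of radius R containing a farthest point m also contains -m, and these are at
  distance 2 \<open>norm m\<close>; hence \<open>norm m \<le> R\<close>.\<close>

lemma norm_le_rel_circumradius:
  fixes K :: "'a::euclidean_space set"
  assumes "compact K" and sym: "\<And>x. x \<in> K \<Longrightarrow> - x \<in> K" and x: "x \<in> K"
  shows "norm x \<le> rel_circumradius K (cball 0 1)"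
proof -
  have image: "(+) y ` (*\<^sub>R) R ` cball 0 1 = cball y R" if "0 \<le> R" for R and y :: 'a
    using that by (simp add: scaleR_image_cball_0_1 cball_translation[symmetric])
  obtain m where m: "m \<in> K" "\<And>y. y \<in> K \<Longrightarrow> norm y \<le> norm m"
    using continuous_attains_sup[of K norm] assms by (auto intro: continuous_intros)
  \<comment> \<open>The exact value is established because \<open>LEAST\<close> over the reals is
    informative only once a least element is exhibited.\<close>
  have "rel_circumradius K (cball 0 1) = norm m"
    unfolding rel_circumradius_def
  proof (rule Least_equality)
    show "0 \<le> norm m \<and> (\<exists>y. K \<subseteq> (+) y ` (*\<^sub>R) (norm m) ` cball 0 1)"
      using m by (auto simp: image simp del: image_image intro!: exI[of _ 0])
  next
    fix R assume R: "0 \<le> R \<and> (\<exists>y. K \<subseteq> (+) y ` (*\<^sub>R) R ` cball 0 1)"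
    then obtain y where "K \<subseteq> cball y R" by (metis image)
    then have "dist y m \<le> R" "dist y (- m) \<le> R"
      using m(1) sym[OF m(1)] unfolding subset_eq mem_cball by blast+
    then have "dist m (- m) \<le> 2 * R"
      using dist_triangle2[of m "- m" y] by (simp add: dist_commute)
    moreover have "dist m (- m) = 2 * norm m"
      by (simp add: dist_norm flip: scaleR_2)
    ultimately show "norm m \<le> R" by simp
  qed
  then show ?thesis using m(2)[OF x] by simp
qed

text \<open>Nonreal roots have real part -b/2c, and left of -R the quadratic is decreasing.\<close>

lemma Re_quadratic_root_gt:
  fixes a b c R :: real and w :: complex
  assumes "c > 0" "b < 2 * c * R" "a - b * R + c * R\<^sup>2 > 0"
    and root: "of_real a + of_real b * w + of_real c * w\<^sup>2 = 0"
  shows "- R < Re w"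
proof -
  have Im: "Im w * (b + 2 * c * Re w) = 0"
    using arg_cong[OF root, of Im] by (simp add: algebra_simps power2_eq_square)
  have Re: "a + b * Re w + c * ((Re w)\<^sup>2 - (Im w)\<^sup>2) = 0"
    using arg_cong[OF root, of Re] by (simp add: power2_eq_square)
  show ?thesis
  proof (cases "Im w = 0")
    case False
    with Im have "b + 2 * c * Re w = 0" by simp
    with assms(2) have "2 * c * (- R) < 2 * c * Re w" unfolding mult_minus_right by linarith
    moreover have "0 < 2 * c" using assms(1) by simp
    ultimately show ?thesis by (simp only: mult_less_cancel_left_pos)
  next
    case True
    show ?thesis
    proof (rule ccontr)
      assume "\<not> - R < Re w"
      then have le: "Re w + R \<le> 0" by simp
      then have "c * (Re w + R) \<le> 0"
        using assms(1) by (simp add: mult_le_0_iff)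
      then have "c * (Re w - R) + b \<le> 0"
        using assms(2) by (simp add: algebra_simps)
      \<comment> \<open>The product is the value of the quadratic at \<open>Re w\<close> minus its
        value at -R. The former is 0 and the latter positive.\<close>
      then have "0 \<le> (Re w + R) * (c * (Re w - R) + b)"
        using le by (simp add: zero_le_mult_iff)
      with Re True assms(3) show False
        by (simp add: algebra_simps power2_eq_square)
    qed
  qed
qed

section \<open>Transfer between Euclidean spaces of equal dimension\<close>

text \<open>The map matches the standard bases. Preimages of boxes are boxes with the same side
  lengths, so it preserves Lebesgue measure. It carries the computations in
  \<open>real \<times> real \<times> real\<close>, where slicing is natural, to
  \<open>real ^ 3\<close>.\<close>

lemma basis_isometry:
  assumes "DIM('a::euclidean_space) = DIM('b::euclidean_space)"
  obtains f :: "'a::euclidean_space \<Rightarrow> 'b::euclidean_space" where "linear f" "\<And>x. norm (f x) = norm x" "surj f"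
    "\<And>S. S \<in> sets borel \<Longrightarrow> emeasure lborel (f -` S) = emeasure lborel S"
proof -
  obtain g :: "'a \<Rightarrow> 'b" where g: "bij_betw g Basis Basis"
    using assms finite_same_card_bij[OF finite_Basis finite_Basis] by blast
  then have g_in: "g b \<in> Basis" if "b \<in> Basis" for b
    using that by (auto dest: bij_betwE)
  define f where "f x = (\<Sum>b\<in>Basis. (x \<bullet> b) *\<^sub>R g b)" for x
  have lin: "linear f"
    by (auto intro!: linearI simp: f_def inner_add_left scaleR_add_left sum.distrib scaleR_sum_right)
  have f_inner: "f x \<bullet> g b = x \<bullet> b" if "b \<in> Basis" for x b
  proof -
    have "f x \<bullet> g b = (\<Sum>b'\<in>Basis. (x \<bullet> b') * (g b' \<bullet> g b))"
      by (simp add: f_def inner_sum_left)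
    also have "\<dots> = (\<Sum>b'\<in>Basis. if b' = b then x \<bullet> b' else 0)"
      using g that by (intro sum.cong refl) (auto simp: inner_Basis g_in bij_betw_def inj_on_eq_iff)
    finally show ?thesis using that by simp
  qed
  have inner: "f x \<bullet> f y = x \<bullet> y" for x y
  proof -
    have "f x \<bullet> f y = (\<Sum>b\<in>Basis. (f x \<bullet> b) * (f y \<bullet> b))"
      by (rule euclidean_inner)
    also have "\<dots> = (\<Sum>b\<in>Basis. (x \<bullet> b) * (y \<bullet> b))"
      by (subst sum.reindex_bij_betw[OF g, symmetric]) (simp add: f_inner)
    finally show ?thesis by (simp only: euclidean_inner[of x y])
  qed
  then have nrm: "norm (f x) = norm x" for x
    by (simp add: norm_eq_sqrt_inner)
  have "inj f"
    using lin nrm by (metis linear_injective_0 norm_eq_zero)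
  have "surj f"
  proof -
    have "dim (range f) = DIM('b)"
      using dim_image_eq[OF lin, of UNIV] \<open>inj f\<close> assms by simp
    then show ?thesis
      using dim_eq_full[of "range f"] linear_subspace_image[OF lin subspace_UNIV]
      by (metis span_eq_iff)
  qed
  have [measurable]: "f \<in> borel_measurable borel"
    using lin by (intro borel_measurable_continuous_onI linear_continuous_on) (simp add: linear_conv_bounded_linear)
  have "lborel = distr lborel borel f"
  proof (rule lborel_eqI)
    fix l u :: 'b
    assume le: "\<And>b. b \<in> Basis \<Longrightarrow> l \<bullet> b \<le> u \<bullet> b"
    obtain l' u' where lu: "f l' = l" "f u' = u"
      using \<open>surj f\<close> by (metis surjD)
    have "f -` box l u = box l' u'"
    proof -
      have "x \<in> f -` box l u \<longleftrightarrow> (\<forall>b\<in>g ` Basis. l \<bullet> b < f x \<bullet> b \<and> f x \<bullet> b < u \<bullet> b)" for x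
        using g by (simp add: mem_box bij_betw_def)
      also have "\<dots> x \<longleftrightarrow> x \<in> box l' u'" for x
        by (simp add: mem_box f_inner flip: lu)
      finally show ?thesis by blast
    qed
    moreover have "l' \<bullet> b \<le> u' \<bullet> b" if "b \<in> Basis" for b
      using le[OF g_in[OF that]] that by (simp add: f_inner flip: lu)
    moreover have "(\<Prod>b\<in>Basis. (u - l) \<bullet> b) = (\<Prod>b\<in>Basis. (u' - l') \<bullet> b)"
      by (subst prod.reindex_bij_betw[OF g, symmetric])
         (simp add: inner_diff_left f_inner flip: lu)
    ultimately show "emeasure (distr lborel borel f) (box l u) = (\<Prod>b\<in>Basis. (u - l) \<bullet> b)"
      by (simp add: emeasure_distr)
  qed simp
  then have "emeasure lborel (f -` S) = emeasure lborel S" if "S \<in> sets borel" for S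
    using that emeasure_distr[of f lborel borel S] by simp
  with lin nrm \<open>surj f\<close> show thesis
    by (rule that)
qed


section \<open>The decagon and its outer parallel body\<close>

theorem theorem1p3:
  "\<exists>K :: (real ^ 3) set. convex_body K \<and> interior K \<noteq> {} \<and>
     (\<forall>z :: complex. poly (steiner_poly K (cball 0 1)) z = 0
        \<longrightarrow> Re z > - rel_circumradius K (cball 0 1))"
proof -
  obtain f :: "real \<times> real \<times> real \<Rightarrow> real ^ 3" where f: "linear f" "\<And>x. norm (f x) = norm x" "surj f"
    and vol: "\<And>S. S \<in> sets borel \<Longrightarrow> emeasure lborel (f -` S) = emeasure lborel S"
    by (rule basis_isometry[where 'a="real \<times> real \<times> real" and 'b="real ^ 3"]) auto
  have f_cball: "f ` cball 0 r = cball 0 r" for r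
  proof -
    have "f ` cball 0 r \<supseteq> cball 0 r"
      using f(2,3) by (force simp: image_iff dest: surjD)
    then show ?thesis using f(2) by auto
  qed
  have "inj f"
    using f by (metis linear_injective_0 norm_eq_zero)
  \<comment> \<open>Half-edges with Pythagorean directions, so that all lengths are integers; their sum (282, 0)
    is the farthest vertex.\<close>
  define vs :: "(real \<times> real) list" where "vs = [(68, 0), (32, 60), (32, - 60), (75, 40), (75, - 40)]"
  define Z :: "(real \<times> real \<times> real) set" where "Z = {0} \<times> zonotope vs"
  define K where "K = f ` (Z + cball 0 1)"
  have "norm (32 :: real, 60 :: real) = 68" "norm (75 :: real, 40 :: real) = 85"
    by (simp_all add: norm_Pair real_sqrt_unique)
  then have \<Lambda>: "(\<Sum>v\<leftarrow>vs. norm v) = 374"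
    by (simp add: vs_def norm_Pair)
  have vs_pos: "\<forall>v\<in>set vs. 0 < fst v"
    by (simp add: vs_def)
  have C: "sum_abs_det2 vs = 41440"
    by (simp add: vs_def det2_def)
  have Z: "compact Z" "convex Z" "\<And>x. x \<in> Z \<Longrightarrow> - x \<in> Z" "0 \<in> Z"
    using zero_in_zonotope[of vs] uminus_in_zonotope[of _ vs]
    by (auto simp: Z_def zero_prod_def compact_zonotope convex_zonotope
        intro!: compact_Times convex_Times)
  have K_plus: "K + (*\<^sub>R) \<rho> ` cball 0 1 = f ` (Z + cball 0 (1 + \<rho>))" if "0 \<le> \<rho>" for \<rho>
    using that unfolding K_def
    by (simp add: scaleR_image_cball_0_1 image_plus_linear[OF f(1)] f_cball add.assoc cball_0_plus_cball_0)
  \<comment> \<open>The volume of \<open>Z + cball 0 r\<close> is a r + b r^2 + c r^3, with a = 8 *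
    41440 and b = 2 pi * 374. The polynomial p is this cubic expanded at r = 1 + \<rho>.\<close>
  define a b c :: real where abc: "a = 331520" "b = 748 * pi" "c = 4 / 3 * pi"
  define p where "p = [:a + b + c, a + 2 * b + 3 * c, b + 3 * c, c:]"
  have "measure lebesgue (K + (*\<^sub>R) \<rho> ` cball 0 1) = poly p \<rho>" if "0 \<le> \<rho>" for \<rho>
  proof -
    define V where "V = c * (1 + \<rho>) ^ 3 + b * (1 + \<rho>)\<^sup>2 + a * (1 + \<rho>)"
    have "0 \<le> V" using that by (simp add: V_def abc)
    have S: "f ` (Z + cball 0 (1 + \<rho>)) \<in> sets borel"
      using Z f(1) by (intro borel_compact compact_continuous_image compact_plus linear_continuous_on compact_cball)
        (simp_all add: linear_conv_bounded_linear)
    have "emeasure lborel (f ` (Z + cball 0 (1 + \<rho>))) = emeasure lborel (Z + cball 0 (1 + \<rho>))"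
      using vol[OF S] \<open>inj f\<close> by (simp add: inj_vimage_image_eq)
    also have "\<dots> = ennreal V"
      unfolding Z_def using that vs_pos by (simp add: emeasure_zonotope_plus_cball_space \<Lambda> C V_def abc)
    finally have "measure lborel (f ` (Z + cball 0 (1 + \<rho>))) = V"
      using \<open>0 \<le> V\<close> by (simp add: measure_def)
    then have "measure lebesgue (f ` (Z + cball 0 (1 + \<rho>))) = V"
      using S by (simp add: measure_completion)
    also have "V = poly p \<rho>"
      by (simp add: V_def p_def algebra_simps power2_eq_square power3_eq_cube)
    finally show ?thesis using that by (simp add: K_plus)
  qed
  then have steiner: "steiner_poly K (cball 0 1) = map_poly of_real p"
    by (rule steiner_poly_eqI) (simp_all add: p_def)
  have "compact K"
    unfolding K_def using Z f(1) by (intro compact_continuous_image compact_plus linear_continuous_on compact_cball)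
        (simp_all add: linear_conv_bounded_linear)
  moreover have "convex K"
    unfolding K_def using Z f(1) by (intro convex_linear_image convex_set_plus convex_cball)
  moreover have "interior K \<noteq> {}"
  proof -
    have "cball 0 1 \<subseteq> Z + cball 0 1"
      using Z by (intro set_zero_plus2)
    then have "cball 0 1 \<subseteq> K"
      unfolding K_def using f_cball by blast
    then have "interior (cball 0 1) \<subseteq> interior K"
      by (rule interior_mono)
    then show ?thesis by auto
  qed
  moreover have R: "283 \<le> rel_circumradius K (cball 0 1)"
  proof -
    have "(0, 282, 0) \<in> Z"
    proof -
      have "sum_list vs = (282, 0)" by (simp add: vs_def)
      then show ?thesis
        using sum_list_in_zonotope[of vs] by (simp add: Z_def)
    qed
    \<comment> \<open>The unit ball prolongs the farthest vertex in its own direction, from norm 282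
      to norm 283.\<close>
    moreover have "(0, 1, 0) \<in> (cball 0 1 :: (real \<times> real \<times> real) set)"
      by (simp add: norm_Pair)
    ultimately have "f ((0, 282, 0) + (0, 1, 0)) \<in> K"
      unfolding K_def by (intro imageI set_plus_intro)
    then have "f (0, 283, 0) \<in> K"
      by simp
    moreover have "- x \<in> K" if x: "x \<in> K" for x
    proof -
      obtain z y where "x = f (z + y)" "z \<in> Z" "y \<in> cball 0 1"
        using x unfolding K_def by (blast elim: set_plus_elim)
      then have "- x = f (- z + - y)" "- z \<in> Z" "- y \<in> cball 0 1"
        using Z(3) by (simp_all add: linear_neg[OF f(1)] linear_add[OF f(1)] linear_diff[OF f(1)])
      then show ?thesis
        unfolding K_def by (simp only: imageI set_plus_intro)
    qed
    ultimately have "norm (f (0, 283, 0)) \<le> rel_circumradius K (cball 0 1)"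
      using \<open>compact K\<close> by (intro norm_le_rel_circumradius)
    then show ?thesis
      by (simp add: f(2) norm_Pair)
  qed
  moreover have "- 283 < Re z" if root: "poly (steiner_poly K (cball 0 1)) z = 0" for z
  proof -
    \<comment> \<open>In the variable 1 + z this is the volume cubic of the flat decagon; the factor
      1 + z reflects that the decagon has volume 0.\<close>
    have "poly (steiner_poly K (cball 0 1)) z
        = (1 + z) * (of_real a + of_real b * (1 + z) + of_real c * (1 + z)\<^sup>2)"
      unfolding steiner by (simp add: p_def map_poly_pCons algebra_simps power2_eq_square)
    with root consider "1 + z = 0"
      | "of_real a + of_real b * (1 + z) + of_real c * (1 + z)\<^sup>2 = 0"
      by (metis mult_eq_0_iff)
    then show ?thesis
    proof cases
      case 1
      then have "Re (1 + z) = 0" by (simp only: zero_complex.sel)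
      then show ?thesis by simp
    next
      case 2
      \<comment> \<open>The bound is taken at 282, the norm of the farthest vertex, since the root
        is shifted by 1. After division by pi the second inequality is 748 < 752.\<close>
      have "0 < c" "b < 2 * c * 282"
        by (simp_all add: abc)
      \<comment> \<open>The value is 331520 - 104904 pi, so pi < 3.16 suffices.\<close>
      moreover have "0 < a - b * 282 + c * 282\<^sup>2"
        using pi_approx(2) by (simp add: abc)
      ultimately have "- 282 < Re (1 + z)"
        using 2 by (rule Re_quadratic_root_gt)
      then show ?thesis by simp
    qed
  qed
  ultimately show ?thesis
    using R unfolding convex_body_def by (intro exI[of _ K] conjI allI impI) (auto intro: order_le_less_trans[of _ "- 283"])
qed

end
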